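(* For every integer $n\geq 1$, the algorithm $\mathrm{EnumBP}$ (described in the context) on input $n$ enumerates $\mathsf{BP}_n$: identifying each output with the partitioned order it represents, every element of $\mathsf{BP}_n$ is output exactly once and nothing else is output.
   Context: Notation: $\llbracket n\rrbracket=\{0,\dots,n-1\}$. A partitioned order of $\llbracket n\rrbracket$ is an (unordered) set $\{S_k\}_{k\in\llbracket s\rrbracket}$ of $s$ non-empty finite sequences, each consisting of pairwise distinct elements of $\llbracket n\rrbracket$, the sequences being pairwise disjoint (as sets of entries) with union $\llbracket n\rrbracket$; so every element of $\llbracket n\rrbracket$ occurs at exactly one position of exactly one sequence. The sequences are called o-blocks. $\mathsf{BP}_n$ is the set of all partitioned orders of $\llbracket n\rrbracket$ (block-parallel update modes of size $n$). Integer partitions: $p(n)$ is the number of integer partitions of $n$, listed in some fixed order as partitions number $1,\dots,p(n)$; $d(i)$ is the maximal part size of the $i$-th partition, and $m(i,j)$ is the multiplicity of the part of size $j$ in it (possibly $0$). Matrix representation: a list $M=(M_1,\dots,M_{d(i)})$, where $M_j$ is a matrix with $m(i,j)$ rows and $j$ columns (empty if $m(i,j)=0$) such that each element of $\llbracket n\rrbracket$ is an entry exactly once overall, represents the partitioned order whose o-blocks are all the rows of all the matrices (each row read from left to right). Algorithm $\mathrm{EnumBP}(n)$: for each $i$ from $1$ to $p(n)$, call $\mathrm{Aux}(n,i,1)$. $\mathrm{Aux}(n,i,j,M_1,\dots,M_{j-1})$: (1) If $d(i)<j$, output $M=(M_1,\dots,M_{j-1})$ and return. (2) Otherwise, if $m(i,j)>0$: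 for each subset $A$ of size $j\cdot m(i,j)$ of the elements of $\llbracket n\rrbracket$ not occurring in $M_1,\dots,M_{j-1}$, and for each subset $C\subseteq A$ of size $m(i,j)$: sort $C$ increasingly as $C[1]<\dots<C[m(i,j)]$ and set $M_j[k][1]=C[k]$ for $1\le k\le m(i,j)$; then for each ordering (permutation) $B$ of $A\setminus C$, set $M_j[k][\ell]=B[(k-1)(j-1)+\ell-1]$ for $1\le k\le m(i,j)$, $2\le\ell\le j$ (with $B$ indexed from $1$), and call $\mathrm{Aux}(n,i,j+1,M_1,\dots,M_{j-1},M_j)$. (3) Otherwise ($m(i,j)=0$), call $\mathrm{Aux}(n,i,j+1,M_1,\dots,M_{j-1},\emptyset)$. *)

theory Defs
  imports
    "Jordan_Normal_Form.Matrix"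
    "HOL-Library.Multiset"
    "HOL-Combinatorics.Multiset_Permutations"
begin

definition BP :: "nat \<Rightarrow> nat list set set" where
  "BP n = {P. finite P \<and>
     (\<forall>S\<in>P. S \<noteq> [] \<and> distinct S \<and> set S \<subseteq> {..<n}) \<and>
     (\<forall>S\<in>P. \<forall>T\<in>P. S \<noteq> T \<longrightarrow> set S \<inter> set T = {}) \<and>
     (\<Union>S\<in>P. set S) = {..<n}}"

text \<open>An integer partition is the multiset of its parts, so \<open>m(i,j)\<close> is
  \<^term>\<open>count \<mu> j\<close> when \<open>\<mu>\<close> is the \<open>i\<close>-th partition.\<close>

definition int_partitions :: "nat \<Rightarrow> nat multiset set" where
  "int_partitions n = {\<mu>. (\<forall>j \<in># \<mu>. j > 0) \<and> sum_mset \<mu> = n}"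

definition num_partitions :: "nat \<Rightarrow> nat" where
  "num_partitions n = card (int_partitions n)"

definition partition_listing :: "nat \<Rightarrow> (nat \<Rightarrow> nat multiset) \<Rightarrow> bool" where
  "partition_listing n part \<longleftrightarrow> bij_betw part {1..num_partitions n} (int_partitions n)"

definition max_part :: "nat multiset \<Rightarrow> nat" where
  "max_part \<mu> = Max (set_mset \<mu>)"

text \<open>The matrix \<open>M\<^sub>j\<close> is the list element with index \<open>j - 1\<close>.\<close>

definition is_matrix_rep :: "nat \<Rightarrow> nat multiset \<Rightarrow> nat mat list \<Rightarrow> bool" where
  "is_matrix_rep n \<mu> Ms \<longleftrightarrow>
     length Ms = max_part \<mu> \<and>
     (\<forall>j\<in>{1..max_part \<mu>}. Ms ! (j - 1) \<in> carrier_mat (count \<mu> j) j) \<and>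
     (\<Union>M\<in>set Ms. elements_mat M) \<subseteq> {..<n} \<and>
     (\<forall>x<n. card {(t, k, l). t < length Ms \<and> k < dim_row (Ms ! t) \<and> l < dim_col (Ms ! t)
                     \<and> Ms ! t $$ (k, l) = x} = 1)"

definition represented_order :: "nat mat list \<Rightarrow> nat list set" where
  "represented_order Ms = {list_of_vec (row M k) | M k. M \<in> set Ms \<and> k < dim_row M}"

text \<open>The matrix \<open>M\<^sub>j\<close> filled from \<open>C\<close> (first column, increasing) and the ordering \<open>B\<close>.
  Everything is indexed from \<open>0\<close> here: with \<open>k\<close> and \<open>l\<close> shifted by one, the position
  \<open>(k - 1)(j - 1) + l - 1\<close> of the \<open>1\<close>-indexed \<open>B\<close> becomes \<open>k(j - 1) + (l - 1)\<close>.\<close>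

definition fill_matrix :: "nat \<Rightarrow> nat \<Rightarrow> nat set \<Rightarrow> nat list \<Rightarrow> nat mat" where
  "fill_matrix m j C B =
     mat m j (\<lambda>(k, l). if l = 0 then sorted_list_of_set C ! k else B ! (k * (j - 1) + (l - 1)))"

text \<open>The algorithm does not specify the order in which its loops run through subsets and
  permutations; its result is therefore the multiset of all outputs, each loop contributing the
  multiset sum of the outputs of its iterations. All sets summed over are finite.\<close>

function EnumBP_aux :: "nat \<Rightarrow> nat multiset \<Rightarrow> nat \<Rightarrow> nat mat list \<Rightarrow> nat mat list multiset" where
  "EnumBP_aux n \<mu> j Ms =
     (if max_part \<mu> < j then {#Ms#}
      else if count \<mu> j > 0 then
        (\<Sum>A \<in> {A. A \<subseteq> {..<n} - (\<Union>M\<in>set Ms. elements_mat M) \<and> card A = j * count \<mu> j}.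
         \<Sum>C \<in> {C. C \<subseteq> A \<and> card C = count \<mu> j}.
         \<Sum>B \<in> permutations_of_set (A - C).
           EnumBP_aux n \<mu> (Suc j) (Ms @ [fill_matrix (count \<mu> j) j C B]))
      else EnumBP_aux n \<mu> (Suc j) (Ms @ [0\<^sub>m 0 j]))"
  by pat_completeness auto
termination
  by (relation "Wellfounded.measure (\<lambda>(n, \<mu>, j, Ms). Suc (max_part \<mu>) - j)") auto

declare EnumBP_aux.simps [simp del]

definition EnumBP :: "(nat \<Rightarrow> nat multiset) \<Rightarrow> nat \<Rightarrow> nat mat list multiset" where
  "EnumBP part n = (\<Sum>i\<in>{1..num_partitions n}. EnumBP_aux n (part i) 1 [])"

end

theory Submission
  imports Defs
begin

text \<open>The blocks of length \<open>j\<close> of a partitioned order are recovered from a unique triple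
  \<open>(A, C, B)\<close>: \<open>A\<close> is the set of their elements, \<open>C\<close> the set of their heads, and listing the
  blocks by increasing head and concatenating the tails gives \<open>B\<close>. Hence, for fixed \<open>P \<in> BP n\<close>,
  a call of the algorithm whose matrices represent the blocks of \<open>P\<close> of length less than \<open>j\<close>
  has exactly one iteration that continues to agree with \<open>P\<close>, and \<open>P\<close> is reached only from the
  partition given by its own block sizes. Conversely, the entries placed by the algorithm are
  pairwise distinct, and since the parts sum to \<open>n\<close> they exhaust \<open>{..<n}\<close>.\<close>

section \<open>Row-major numbering, and matrices as sets of rows\<close>

lemma mlex_less: "k < m \<Longrightarrow> q < p \<Longrightarrow> k * p + q < m * (p::nat)"
proof -
  assume "k < m" "q < p"
  then have "k * p + q < Suc k * p" by simp
  also have "\<dots> \<le> m * p" using \<open>k < m\<close> by (intro mult_le_mono1) simp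
  finally show ?thesis .
qed

text \<open>Division with remainder by \<open>p\<close> recovers the cell from its row-major number.
  With \<open>p = j - 1\<close> this addresses the tails of the rows inside
  \<open>B\<close>.\<close>

lemma mlex_inj:
  assumes "k * p + q = k' * p + q'" and "q < p" and "q' < (p::nat)"
  shows "k = k' \<and> q = q'"
proof -
  have "(k * p + q) div p = k" "(k' * p + q') div p = k'" using assms(2,3) by simp_all
  with assms(1) have "k = k'" by metis
  with assms(1) show ?thesis by simp
qed

text \<open>A set, because a partitioned order is unordered. Equal rows would collapse, so the
  number of blocks contributed by a matrix needs an argument of its own.\<close>

definition mat_rows :: "'a mat \<Rightarrow> 'a list set" where
  "mat_rows M = (\<lambda>k. list_of_vec (row M k)) ` {..<dim_row M}"

lemma finite_mat_rows [simp]: "finite (mat_rows M)"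
  by (simp add: mat_rows_def)

lemma length_mat_rows: "S \<in> mat_rows M \<Longrightarrow> length S = dim_col M"
  by (auto simp: mat_rows_def)

lemma nth_row: "k < dim_row M \<Longrightarrow> l < dim_col M \<Longrightarrow> list_of_vec (row M k) ! l = M $$ (k, l)"
  by simp

lemma set_row: "k < dim_row M \<Longrightarrow> set (list_of_vec (row M k)) = (\<lambda>l. M $$ (k, l)) ` {..<dim_col M}"
  by (force simp: set_conv_nth)

lemma elements_mat_image:
  "elements_mat M = (\<lambda>(k, l). M $$ (k, l)) ` ({..<dim_row M} \<times> {..<dim_col M})"
  by (force simp: elements_mat_def)

lemma Union_mat_rows: "(\<Union>S\<in>mat_rows M. set S) = elements_mat M"
  unfolding elements_mat_image mat_rows_def by (auto simp: set_row)

lemma represented_order_eq: "represented_order Ms = (\<Union>M\<in>set Ms. mat_rows M)"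
  by (auto simp: represented_order_def mat_rows_def)

lemma Union_represented_order: "(\<Union>S\<in>represented_order Ms. set S) = (\<Union>M\<in>set Ms. elements_mat M)"
  by (simp add: represented_order_eq flip: Union_mat_rows)

section \<open>One round of the algorithm: the choices that fill a single matrix\<close>

definition fill_choices :: "nat set \<Rightarrow> nat \<Rightarrow> nat \<Rightarrow> (nat set \<times> nat set \<times> nat list) set" where
  "fill_choices U m j =
     (SIGMA A : {A. A \<subseteq> U \<and> card A = j * m}. SIGMA C : {C. C \<subseteq> A \<and> card C = m}. permutations_of_set (A - C))"

lemma finite_fill_choices: "finite U \<Longrightarrow> finite (fill_choices U m j)"
  unfolding fill_choices_def
  by (intro finite_SigmaI) (auto dest: finite_subset)

text \<open>Turns the three nested loops into one sum, so that "exactly one iteration agrees"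
  becomes a statement about a single index.\<close>

lemma sum_fill_choices:
  assumes "finite U"
  shows "(\<Sum>A \<in> {A. A \<subseteq> U \<and> card A = j * m}. \<Sum>C \<in> {C. C \<subseteq> A \<and> card C = m}.
            \<Sum>B \<in> permutations_of_set (A - C). f A C B)
         = (\<Sum>(A, C, B)\<in>fill_choices U m j. f A C B)"
proof -
  have fC: "finite {C. C \<subseteq> A \<and> card C = m}" if "A \<subseteq> U" for A
    using finite_subset[OF that assms] by simp
  have fA: "finite {A. A \<subseteq> U \<and> card A = j * m}"
    using assms by simp
  have "(\<Sum>(A, C, B)\<in>fill_choices U m j. f A C B) =
        (\<Sum>A \<in> {A. A \<subseteq> U \<and> card A = j * m}.
          \<Sum>(C, B) \<in> (SIGMA C : {C. C \<subseteq> A \<and> card C = m}. permutations_of_set (A - C)). f A C B)"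
    unfolding fill_choices_def using fA fC by (subst sum.Sigma) (auto simp: finite_SigmaI)
  also have "\<dots> = (\<Sum>A \<in> {A. A \<subseteq> U \<and> card A = j * m}. \<Sum>C \<in> {C. C \<subseteq> A \<and> card C = m}.
            \<Sum>B \<in> permutations_of_set (A - C). f A C B)"
    using fC by (intro sum.cong refl) (subst sum.Sigma, auto)
  finally show ?thesis ..
qed

context
  fixes U A C :: "nat set" and B :: "nat list" and m j :: nat
  assumes U: "finite U" and j: "j > 0" and choice: "(A, C, B) \<in> fill_choices U m j"
begin

lemma fill_facts:
  shows fill_A: "A \<subseteq> U" "finite A" "card A = j * m" and fill_C: "C \<subseteq> A" "finite C" "card C = m"
    and fill_B: "set B = A - C" "distinct B" "length B = m * (j - 1)"
proof -
  show 1: "A \<subseteq> U" "card A = j * m" "C \<subseteq> A" "card C = m" "set B = A - C" "distinct B"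
    using choice by (auto simp: fill_choices_def permutations_of_set_def)
  then show 2: "finite A" "finite C" using U finite_subset by metis+
  have "length B = card (A - C)" using 1 distinct_card by metis
  also have "\<dots> = j * m - m" using 1 2 card_Diff_subset by metis
  finally show "length B = m * (j - 1)" by (simp add: algebra_simps)
qed

lemma fill_dim [simp]: "dim_row (fill_matrix m j C B) = m" "dim_col (fill_matrix m j C B) = j"
  by (simp_all add: fill_matrix_def)

lemma fill_index_0: "k < m \<Longrightarrow> fill_matrix m j C B $$ (k, 0) = sorted_list_of_set C ! k"
  using j by (simp add: fill_matrix_def)

lemma fill_index_Suc: "k < m \<Longrightarrow> q < j - 1 \<Longrightarrow> fill_matrix m j C B $$ (k, Suc q) = B ! (k * (j - 1) + q)"
  by (simp add: fill_matrix_def)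

lemma fill_index_0_mem: "k < m \<Longrightarrow> fill_matrix m j C B $$ (k, 0) \<in> C"
  using fill_C by (metis fill_index_0 length_sorted_list_of_set nth_mem set_sorted_list_of_set)

lemma fill_index_Suc_mem: "k < m \<Longrightarrow> q < j - 1 \<Longrightarrow> fill_matrix m j C B $$ (k, Suc q) \<in> A - C"
  using fill_B by (metis fill_index_Suc mlex_less nth_mem)

text \<open>Column 0 runs through \<open>C\<close> without repetition, the other columns run through
  \<open>A - C\<close> without repetition at distinct row-major positions, and these two sets are
  disjoint.\<close>

lemma fill_inj:
  "inj_on (\<lambda>(k, l). fill_matrix m j C B $$ (k, l)) ({..<m} \<times> {..<j})"
proof -
  have "k = k' \<and> l = l'"
    if b: "k \<in> {..<m}" "k' \<in> {..<m}" "l \<in> {..<j}" "l' \<in> {..<j}"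
      and eq: "fill_matrix m j C B $$ (k, l) = fill_matrix m j C B $$ (k', l')"
    for k l k' l'
  proof (cases l; cases l')
    assume "l = 0" "l' = 0"
    then show ?thesis
      using b eq fill_C nth_eq_iff_index_eq[of "sorted_list_of_set C" k k']
      by (simp add: fill_index_0)
  next
    fix q q' assume q: "l = Suc q" "l' = Suc q'"
    then have *: "q < j - 1" "q' < j - 1" using b by auto
    then have "k * (j - 1) + q = k' * (j - 1) + q'"
      using b eq q fill_B nth_eq_iff_index_eq[of B "k * (j - 1) + q" "k' * (j - 1) + q'"]
      by (simp add: fill_index_Suc mlex_less del: One_nat_def)
    then show ?thesis using * q mlex_inj by blast
  next
    fix q assume "l = 0" "l' = Suc q"
    then show ?thesis
      using b eq fill_index_0_mem[of k] fill_index_Suc_mem[of k' q] by force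
  next
    fix q assume "l = Suc q" "l' = 0"
    then show ?thesis
      using b eq fill_index_0_mem[of k'] fill_index_Suc_mem[of k q] by force
  qed
  then show ?thesis by (auto simp: inj_on_def)
qed

text \<open>All entries lie in \<open>A\<close>, and by injectivity there are as many of them as
  cells, namely \<open>m * j = card A\<close>.\<close>

lemma elements_fill: "elements_mat (fill_matrix m j C B) = A"
proof (rule card_subset_eq)
  show "finite A" by (rule fill_A)
  show "elements_mat (fill_matrix m j C B) \<subseteq> A"
  proof
    fix x assume "x \<in> elements_mat (fill_matrix m j C B)"
    then obtain k l where "k < m" "l < j" "x = fill_matrix m j C B $$ (k, l)"
      by (auto simp: elements_mat_image)
    then show "x \<in> A"
      using fill_C fill_index_0_mem[of k] fill_index_Suc_mem[of k "l - 1"] by (cases l) auto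
  qed
  show "card (elements_mat (fill_matrix m j C B)) = card A"
    using card_image[OF fill_inj] fill_A by (simp add: elements_mat_image mult.commute)
qed

text \<open>No two rows coincide, since they already differ in their first entry.\<close>

lemma card_mat_rows_fill: "card (mat_rows (fill_matrix m j C B)) = m"
proof -
  have "inj_on (\<lambda>k. list_of_vec (row (fill_matrix m j C B) k)) {..<m}"
  proof (rule inj_onI)
    fix k k' assume k: "k \<in> {..<m}" "k' \<in> {..<m}"
      and "list_of_vec (row (fill_matrix m j C B) k) = list_of_vec (row (fill_matrix m j C B) k')"
    then have "fill_matrix m j C B $$ (k, 0) = fill_matrix m j C B $$ (k', 0)"
      using j nth_row[of _ "fill_matrix m j C B" 0] by fastforce
    then show "k = k'" using inj_onD[OF fill_inj, of "(k, 0)" "(k', 0)"] k j by simp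
  qed
  then show ?thesis by (simp add: mat_rows_def card_image)
qed

end

text \<open>Existence of the triple. It will be applied to the set \<open>R\<close> of all blocks of
  length \<open>j\<close> of a partitioned order, with \<open>U\<close> the elements not yet
  placed.\<close>

lemma ex_fill:
  assumes "finite U" "j > 0" "finite R" "card R = m"
    and len: "\<And>S. S \<in> R \<Longrightarrow> length S = j \<and> distinct S \<and> set S \<subseteq> U"
    and disj: "\<And>S T. S \<in> R \<Longrightarrow> T \<in> R \<Longrightarrow> S \<noteq> T \<Longrightarrow> set S \<inter> set T = {}"
  shows "\<exists>A C B. (A, C, B) \<in> fill_choices U m j \<and> mat_rows (fill_matrix m j C B) = R"
proof -
  define A where "A = (\<Union>S\<in>R. set S)"
  define C where "C = hd ` R"
  have hd_in: "hd S \<in> set S" if "S \<in> R" for S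
    using len[OF that] \<open>j > 0\<close> by (intro hd_in_set) auto
  have hd_inj: "inj_on hd R"
    using disj hd_in by (intro inj_onI) (metis disjoint_iff)
  have C: "finite C" "card C = m" "C \<subseteq> A"
    using hd_in hd_inj assms(3,4) by (auto simp: C_def A_def card_image)
  have "card A = (\<Sum>S\<in>R. card (set S))"
    unfolding A_def using assms(3) disj by (intro card_UN_disjoint) auto
  also have "\<dots> = (\<Sum>S\<in>R. j)"
    using len by (intro sum.cong refl) (auto simp: distinct_card)
  finally have A: "card A = j * m" using assms(4) by simp
  have AU: "A \<subseteq> U" and fA: "finite A" using len \<open>finite R\<close> by (auto simp: A_def)
  \<comment> \<open>\<open>r k\<close> is the block with the \<open>k\<close>-th smallest head.
    Disjointness makes \<open>hd\<close> injective on \<open>R\<close>, so \<open>r\<close>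
    enumerates all of \<open>R\<close>.\<close>
  define r where "r k = inv_into R hd (sorted_list_of_set C ! k)" for k
  have nthC: "sorted_list_of_set C ! k \<in> hd ` R" if "k < m" for k
    using that C nth_mem[of k "sorted_list_of_set C"] by (simp add: C_def)
  have r: "r k \<in> R" "hd (r k) = sorted_list_of_set C ! k" if "k < m" for k
    using nthC[OF that] by (auto simp: r_def inv_into_into f_inv_into_f)
  have r_surj: "\<exists>k<m. r k = S" if "S \<in> R" for S
  proof -
    have "hd S \<in> set (sorted_list_of_set C)" using C that by (simp add: C_def)
    then obtain k where "k < m" "sorted_list_of_set C ! k = hd S"
      using C by (metis in_set_conv_nth length_sorted_list_of_set)
    then show ?thesis using that hd_inj by (auto simp: r_def intro!: exI[of _ k])
  qed
  have r0: "r k ! 0 = sorted_list_of_set C ! k" if "k < m" for k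
    using r[OF that] len[of "r k"] \<open>j > 0\<close> by (metis hd_conv_nth length_greater_0_conv)
  \<comment> \<open>The tails of \<open>r 0\<close>, \<open>r 1\<close>, ... in a row;
    \<open>Suc\<close> skips the head. For \<open>j = 1\<close> the list is empty, so the division
    by \<open>j - 1 = 0\<close> is never evaluated at a position.\<close>
  define B where "B = map (\<lambda>i. r (i div (j - 1)) ! Suc (i mod (j - 1))) [0..<m * (j - 1)]"
  have nthB: "B ! (k * (j - 1) + q) = r k ! Suc q" if "k < m" "q < j - 1" for k q
    using mlex_less[OF that] that by (simp add: B_def)
  \<comment> \<open>It suffices to show that every tail element occurs in \<open>B\<close>: as
    \<open>length B = card (A - C)\<close>, both equality and distinctness follow by
    counting.\<close>
  have "A - C \<subseteq> set B"
  proof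
    fix x assume x: "x \<in> A - C"
    then obtain S where S: "S \<in> R" "x \<in> set S" by (auto simp: A_def)
    then obtain k where k: "k < m" "r k = S" using r_surj by blast
    obtain l where l: "l < j" "x = S ! l" using S len by (metis in_set_conv_nth)
    have "l \<noteq> 0" using x l k r0 nthC by (metis C_def DiffD2)
    then obtain q where "l = Suc q" "q < j - 1" using l by (cases l) auto
    then have "x = B ! (k * (j - 1) + q)" using nthB k l by simp
    moreover have "k * (j - 1) + q < length B"
      using mlex_less[OF \<open>k < m\<close> \<open>q < j - 1\<close>] by (simp add: B_def)
    ultimately show "x \<in> set B" by simp
  qed
  moreover have "card (A - C) = length B"
    using A C by (simp add: card_Diff_subset B_def algebra_simps)
  ultimately have B: "set B = A - C" "distinct B"
    using card_length[of B] card_seteq[of "set B" "A - C"] by (auto intro: card_distinct)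
  have mem: "(A, C, B) \<in> fill_choices U m j"
    using A AU B C by (auto simp: fill_choices_def permutations_of_set_def)
  have rows: "list_of_vec (row (fill_matrix m j C B) k) = r k" if "k < m" for k
  proof (rule nth_equalityI)
    fix l assume "l < length (list_of_vec (row (fill_matrix m j C B) k))"
    then have l: "l < j" by (simp add: fill_matrix_def)
    then have "fill_matrix m j C B $$ (k, l) = r k ! l"
      using that r0 nthB[of k "l - 1"] by (cases l) (simp_all add: fill_matrix_def)
    then show "list_of_vec (row (fill_matrix m j C B) k) ! l = r k ! l"
      using that l by (subst nth_row) (simp_all add: fill_matrix_def)
  qed (use len r that in \<open>simp add: fill_matrix_def\<close>)
  have "mat_rows (fill_matrix m j C B) = r ` {..<m}"
    using rows by (auto simp: mat_rows_def fill_matrix_def)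
  also have "\<dots> = R" using r(1) r_surj by blast
  finally show ?thesis using mem by blast
qed

text \<open>The rows determine \<open>A\<close> as the set of their elements and \<open>C\<close> as
  the set of their first entries. Heads then tell which row has which index, and \<open>B\<close> is
  read off row by row.\<close>

lemma fill_unique:
  assumes U: "finite U" and j: "j > 0"
    and 1: "(A, C, B) \<in> fill_choices U m j" and 2: "(A', C', B') \<in> fill_choices U m j"
    and rows: "mat_rows (fill_matrix m j C B) = mat_rows (fill_matrix m j C' B')"
  shows "A = A' \<and> C = C' \<and> B = B'"
proof -
  note f1 = fill_facts[OF U j 1] and f2 = fill_facts[OF U j 2]
  have A: "A = A'"
    using elements_fill[OF U j 1] elements_fill[OF U j 2] rows by (metis Union_mat_rows)
  have hd: "(\<lambda>S. S ! 0) ` mat_rows (fill_matrix m j C B) = C"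
    if "(A, C, B) \<in> fill_choices U m j" for A C B
  proof -
    note f = fill_facts[OF U j that]
    have "(\<lambda>S. S ! 0) ` mat_rows (fill_matrix m j C B) = (\<lambda>k. sorted_list_of_set C ! k) ` {..<m}"
      unfolding mat_rows_def image_image fill_dim[OF U j that]
      using j by (intro image_cong refl) (simp add: fill_matrix_def)
    also have "\<dots> = set (sorted_list_of_set C)"
      using f by (auto simp: set_conv_nth)
    finally show ?thesis using f by simp
  qed
  have C: "C = C'" using hd[OF 1] hd[OF 2] rows by simp
  \<comment> \<open>Equality of the row sets only provides some row \<open>k'\<close> of the second
    matrix. Comparing heads, which are distinct entries of one sorted list, forces
    \<open>k = k'\<close>.\<close>
  have row_eq: "list_of_vec (row (fill_matrix m j C B) k) = list_of_vec (row (fill_matrix m j C B') k)"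
    if k: "k < m" for k
  proof -
    have "list_of_vec (row (fill_matrix m j C B) k) \<in> mat_rows (fill_matrix m j C B')"
      using rows k C by (auto simp: mat_rows_def fill_matrix_def)
    then obtain k' where k': "k' < m"
      and eq: "list_of_vec (row (fill_matrix m j C B) k) = list_of_vec (row (fill_matrix m j C B') k')"
      by (auto simp: mat_rows_def fill_matrix_def)
    have "sorted_list_of_set C ! k = sorted_list_of_set C ! k'"
      using arg_cong[OF eq, of "\<lambda>S. S ! 0"] j k k' by (simp add: fill_matrix_def)
    then have "k = k'"
      using k k' f1 nth_eq_iff_index_eq[of "sorted_list_of_set C" k k'] by simp
    then show ?thesis using eq by simp
  qed
  have "B = B'"
  proof (rule nth_equalityI)
    show "length B = length B'" using f1 f2 by simp
    fix i assume "i < length B"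
    then have i: "i < m * (j - 1)" using f1 by simp
    define k q where "k = i div (j - 1)" and "q = i mod (j - 1)"
    \<comment> \<open>A valid index \<open>i\<close> excludes \<open>j = 1\<close>, so quotient and
      remainder are meaningful.\<close>
    have "0 < j - 1" using i by (cases "j - 1") auto
    then have kq: "k < m" "q < j - 1" "i = k * (j - 1) + q"
      using i unfolding k_def q_def div_mult_mod_eq by (simp_all add: less_mult_imp_div_less)
    have "fill_matrix m j C B $$ (k, Suc q) = fill_matrix m j C B' $$ (k, Suc q)"
      using arg_cong[OF row_eq[OF kq(1)], of "\<lambda>S. S ! Suc q"] kq by (simp add: fill_matrix_def)
    then show "B ! i = B' ! i"
      using kq by (simp add: fill_matrix_def)
  qed
  with A C show ?thesis by simp
qed


section \<open>Matrix lists with pairwise distinct entries: the invariant of the recursion\<close>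

definition positions :: "'a mat list \<Rightarrow> (nat \<times> nat \<times> nat) set" where
  "positions Ms = (SIGMA t : {..<length Ms}. {..<dim_row (Ms ! t)} \<times> {..<dim_col (Ms ! t)})"

text \<open>In these terms, the requirement that each element be an entry exactly once says that
  \<open>entry Ms\<close> maps \<open>positions Ms\<close> bijectively onto
  \<open>{..<n}\<close>.\<close>

definition entry :: "'a mat list \<Rightarrow> nat \<times> nat \<times> nat \<Rightarrow> 'a" where
  "entry Ms = (\<lambda>(t, k, l). Ms ! t $$ (k, l))"

lemma entry_image: "entry Ms ` positions Ms = (\<Union>M\<in>set Ms. elements_mat M)"
  unfolding elements_mat_image set_conv_nth positions_def entry_def by force

text \<open>The length is left free so that the invariant covers unfinished lists. Only injectivity
  is demanded; surjectivity onto \<open>{..<n}\<close> comes from counting once the list is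
  complete.\<close>

definition partial_rep :: "nat \<Rightarrow> nat multiset \<Rightarrow> nat mat list \<Rightarrow> bool" where
  "partial_rep n \<mu> Ms \<longleftrightarrow>
     (\<forall>t<length Ms. Ms ! t \<in> carrier_mat (count \<mu> (Suc t)) (Suc t)) \<and>
     (\<Union>M\<in>set Ms. elements_mat M) \<subseteq> {..<n} \<and> inj_on (entry Ms) (positions Ms)"

text \<open>The new entries are distinct among themselves by \<open>inj\<close> and differ from all
  old ones by \<open>el\<close>, so injectivity extends to the union of old and new
  positions.\<close>

lemma partial_rep_snoc:
  assumes Ms: "partial_rep n \<mu> Ms"
    and M: "M \<in> carrier_mat (count \<mu> (Suc (length Ms))) (Suc (length Ms))"
    and el: "elements_mat M \<subseteq> {..<n} - (\<Union>M\<in>set Ms. elements_mat M)"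
    and inj: "inj_on (\<lambda>(k, l). M $$ (k, l)) ({..<dim_row M} \<times> {..<dim_col M})"
  shows "partial_rep n \<mu> (Ms @ [M])"
proof -
  let ?new = "Pair (length Ms) ` ({..<dim_row M} \<times> {..<dim_col M})"
  have pos: "positions (Ms @ [M]) = positions Ms \<union> ?new"
    by (auto simp: positions_def nth_append less_Suc_eq)
  have old_entry: "entry (Ms @ [M]) p = entry Ms p" if "p \<in> positions Ms" for p
    using that by (auto simp: positions_def entry_def nth_append)
  have "inj_on (entry (Ms @ [M])) (positions Ms)"
    using Ms old_entry by (simp add: partial_rep_def inj_on_def)
  moreover have "inj_on (entry (Ms @ [M])) ?new"
    using inj by (auto simp: inj_on_def entry_def)
  moreover have "entry (Ms @ [M]) ` positions Ms = (\<Union>M\<in>set Ms. elements_mat M)"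
    using old_entry by (simp flip: entry_image)
  moreover have "entry (Ms @ [M]) ` ?new = elements_mat M"
    unfolding elements_mat_image image_image by (auto simp: entry_def image_iff)
  ultimately have "inj_on (entry (Ms @ [M])) (positions (Ms @ [M]))"
    using el unfolding pos inj_on_Un by blast
  then show ?thesis
    using Ms M el by (auto simp: partial_rep_def nth_append less_Suc_eq)
qed

text \<open>One equation for each branch of the recursion, the last one with the loops merged into a
  single sum.\<close>

lemma EnumBP_aux_leaf: "max_part \<mu> < j \<Longrightarrow> EnumBP_aux n \<mu> j Ms = {#Ms#}"
  by (simp add: EnumBP_aux.simps[of n \<mu> j])

lemma EnumBP_aux_zero:
  "j \<le> max_part \<mu> \<Longrightarrow> count \<mu> j = 0 \<Longrightarrow>
   EnumBP_aux n \<mu> j Ms = EnumBP_aux n \<mu> (Suc j) (Ms @ [0\<^sub>m 0 j])"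
  by (simp add: EnumBP_aux.simps[of n \<mu> j])

lemma EnumBP_aux_step:
  "j \<le> max_part \<mu> \<Longrightarrow> count \<mu> j > 0 \<Longrightarrow>
   EnumBP_aux n \<mu> j Ms =
     (\<Sum>(A, C, B)\<in>fill_choices ({..<n} - (\<Union>M\<in>set Ms. elements_mat M)) (count \<mu> j) j.
        EnumBP_aux n \<mu> (Suc j) (Ms @ [fill_matrix (count \<mu> j) j C B]))"
  by (subst EnumBP_aux.simps[of n \<mu> j]) (simp add: sum_fill_choices)

lemma set_mset_sum: "finite I \<Longrightarrow> set_mset (\<Sum>i\<in>I. f i) = (\<Union>i\<in>I. set_mset (f i))"
  by (induction I rule: finite_induct) auto

text \<open>Induction on the number of matrices still to be built.\<close>

lemma EnumBP_aux_partial_rep: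
  assumes "partial_rep n \<mu> Ms" and "j = Suc (length Ms)" and "j \<le> Suc (max_part \<mu>)"
    and "Ns \<in># EnumBP_aux n \<mu> j Ms"
  shows "partial_rep n \<mu> Ns \<and> length Ns = max_part \<mu>"
  using assms
proof (induction "Suc (max_part \<mu>) - j" arbitrary: j Ms)
  case 0
  then show ?case by (simp add: EnumBP_aux_leaf)
next
  case (Suc d)
  then have j: "j \<le> max_part \<mu>" "j > 0" by auto
  let ?U = "{..<n} - (\<Union>M\<in>set Ms. elements_mat M)"
  \<comment> \<open>Common form of both branches: the output stems from a call with one more matrix
    that keeps the invariant.\<close>
  have "\<exists>M. partial_rep n \<mu> (Ms @ [M]) \<and> Ns \<in># EnumBP_aux n \<mu> (Suc j) (Ms @ [M])"
  proof (cases "count \<mu> j = 0")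
    case True
    have "partial_rep n \<mu> (Ms @ [0\<^sub>m 0 j])"
      using Suc.prems True by (intro partial_rep_snoc) (auto simp: elements_mat_image)
    then show ?thesis
      using Suc.prems True j EnumBP_aux_zero by metis
  next
    case False
    then obtain A C B where ch: "(A, C, B) \<in> fill_choices ?U (count \<mu> j) j"
      and Ns: "Ns \<in># EnumBP_aux n \<mu> (Suc j) (Ms @ [fill_matrix (count \<mu> j) j C B])"
      using Suc.prems(4) j by (auto simp: EnumBP_aux_step set_mset_sum finite_fill_choices)
    have U: "finite ?U" by simp
    have "partial_rep n \<mu> (Ms @ [fill_matrix (count \<mu> j) j C B])"
    proof (rule partial_rep_snoc)
      show "elements_mat (fill_matrix (count \<mu> j) j C B) \<subseteq> ?U"
        using elements_fill[OF U j(2) ch] fill_A(1)[OF U j(2) ch] by simp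
    qed (use Suc.prems(1,2) fill_inj[OF U j(2) ch] in \<open>auto simp: fill_matrix_def\<close>)
    then show ?thesis using Ns by blast
  qed
  then obtain M where "partial_rep n \<mu> (Ms @ [M])" "Ns \<in># EnumBP_aux n \<mu> (Suc j) (Ms @ [M])"
    by blast
  then show ?case
    using Suc.hyps(2) Suc.prems(2) j by (intro Suc.hyps(1)[of "Suc j" "Ms @ [M]"]) auto
qed

text \<open>Groups the parts by size; the hypothesis places all sizes in
  \<open>1, ..., d\<close>.\<close>

lemma sum_mset_eq_sum_count:
  "set_mset \<mu> \<subseteq> Suc ` {..<d} \<Longrightarrow> sum_mset \<mu> = (\<Sum>t<d. count \<mu> (Suc t) * Suc t)"
proof (induction \<mu>)
  case (add x \<mu>)
  then obtain u where u: "x = Suc u" "u < d" by auto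
  have "(\<Sum>t<d. count (add_mset x \<mu>) (Suc t) * Suc t)
      = (\<Sum>t<d. (if t = u then Suc t else 0) + count \<mu> (Suc t) * Suc t)"
    using u by (intro sum.cong) auto
  also have "\<dots> = Suc u + (\<Sum>t<d. count \<mu> (Suc t) * Suc t)"
    using u by (simp add: sum.distrib)
  finally show ?case using add u by simp
qed simp

lemma max_part_ge: "x \<in># \<mu> \<Longrightarrow> x \<le> max_part \<mu>"
  by (simp add: max_part_def)

text \<open>A complete list has as many cells as the sum of the parts, which is \<open>n\<close>. An
  injection from \<open>n\<close> cells into \<open>{..<n}\<close> is onto.\<close>

lemma partial_rep_bij:
  assumes \<mu>: "\<mu> \<in> int_partitions n"
    and Ms: "partial_rep n \<mu> Ms" "length Ms = max_part \<mu>"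
  shows "bij_betw (entry Ms) (positions Ms) {..<n}"
proof -
  have inj: "inj_on (entry Ms) (positions Ms)"
    using Ms by (simp add: partial_rep_def)
  have \<mu>': "set_mset \<mu> \<subseteq> Suc ` {..<max_part \<mu>}" "sum_mset \<mu> = n"
  proof -
    show "set_mset \<mu> \<subseteq> Suc ` {..<max_part \<mu>}"
    proof
      fix x assume x: "x \<in># \<mu>"
      then have "x > 0" "x \<le> max_part \<mu>"
        using \<mu> max_part_ge by (auto simp: int_partitions_def)
      then show "x \<in> Suc ` {..<max_part \<mu>}" by (cases x) auto
    qed
  qed (use \<mu> in \<open>simp add: int_partitions_def\<close>)
  have "card (entry Ms ` positions Ms) = (\<Sum>t<length Ms. dim_row (Ms ! t) * dim_col (Ms ! t))"
    unfolding card_image[OF inj] by (simp add: positions_def)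
  also have "\<dots> = (\<Sum>t<max_part \<mu>. count \<mu> (Suc t) * Suc t)"
  proof (rule sum.cong)
    fix t assume "t \<in> {..<max_part \<mu>}"
    then have "Ms ! t \<in> carrier_mat (count \<mu> (Suc t)) (Suc t)"
      using Ms by (simp add: partial_rep_def)
    then show "dim_row (Ms ! t) * dim_col (Ms ! t) = count \<mu> (Suc t) * Suc t"
      by (metis carrier_matD)
  qed (use Ms in simp)
  also have "\<dots> = n" using sum_mset_eq_sum_count[OF \<mu>'(1)] \<mu>'(2) by simp
  finally have "entry Ms ` positions Ms = {..<n}"
    using Ms unfolding partial_rep_def entry_image by (intro card_subset_eq) auto
  then show ?thesis using inj by (simp add: bij_betw_def)
qed

lemma is_matrix_rep_partial_rep:
  assumes \<mu>: "\<mu> \<in> int_partitions n"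
    and Ms: "partial_rep n \<mu> Ms" "length Ms = max_part \<mu>"
  shows "is_matrix_rep n \<mu> Ms"
proof -
  note bij = partial_rep_bij[OF assms]
  have "card {(t, k, l). t < length Ms \<and> k < dim_row (Ms ! t) \<and> l < dim_col (Ms ! t)
                     \<and> Ms ! t $$ (k, l) = x} = 1" if "x < n" for x
  proof -
    obtain p where p: "p \<in> positions Ms" "entry Ms p = x"
      using bij \<open>x < n\<close> by (metis bij_betw_iff_bijections lessThan_iff)
    have "{q \<in> positions Ms. entry Ms q = x} = {p}"
      using p bij by (auto simp: bij_betw_def inj_on_def)
    moreover have "{(t, k, l). t < length Ms \<and> k < dim_row (Ms ! t) \<and> l < dim_col (Ms ! t)
                     \<and> Ms ! t $$ (k, l) = x} = {q \<in> positions Ms. entry Ms q = x}"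
      by (auto simp: positions_def entry_def)
    ultimately show ?thesis by simp
  qed
  moreover have "Ms ! (j - 1) \<in> carrier_mat (count \<mu> j) j" if "j \<in> {1..max_part \<mu>}" for j
    using that Ms by (cases j) (auto simp: partial_rep_def)
  ultimately show ?thesis
    using Ms by (auto simp: is_matrix_rep_def partial_rep_def)
qed

text \<open>Injectivity of \<open>entry Ms\<close> gives distinctness within a row as well as
  disjointness of different rows, and surjectivity gives the covering. Rows are non-empty because
  the matrix with index \<open>t\<close> has \<open>t + 1\<close> columns.\<close>

lemma represented_order_in_BP:
  assumes \<mu>: "\<mu> \<in> int_partitions n"
    and Ms: "partial_rep n \<mu> Ms" "length Ms = max_part \<mu>"
  shows "represented_order Ms \<in> BP n"
proof -
  have inj: "inj_on (entry Ms) (positions Ms)" and img: "entry Ms ` positions Ms = {..<n}"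
    using partial_rep_bij[OF assms] by (auto simp: bij_betw_def)
  have row: "\<exists>t k. t < length Ms \<and> k < dim_row (Ms ! t) \<and> S = list_of_vec (row (Ms ! t) k)
      \<and> dim_col (Ms ! t) = Suc t" if "S \<in> represented_order Ms" for S
    using that Ms by (auto simp: represented_order_def in_set_conv_nth partial_rep_def)
  have pos: "(t, k, l) \<in> positions Ms \<longleftrightarrow> t < length Ms \<and> k < dim_row (Ms ! t) \<and> l < dim_col (Ms ! t)"
    for t k l by (auto simp: positions_def)
  have "S \<noteq> [] \<and> distinct S" if S: "S \<in> represented_order Ms" for S
  proof -
    obtain t k where tk: "t < length Ms" "k < dim_row (Ms ! t)" "S = list_of_vec (row (Ms ! t) k)"
      "dim_col (Ms ! t) = Suc t"
      using row[OF S] by blast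
    have "l = l'" if "l < Suc t" "l' < Suc t" "S ! l = S ! l'" for l l'
      using inj_onD[OF inj, of "(t, k, l)" "(t, k, l')"] tk that by (simp add: pos entry_def)
    moreover have "length S = Suc t" using tk by simp
    ultimately show ?thesis by (auto simp: distinct_conv_nth)
  qed
  moreover have "set S \<inter> set T = {}"
    if ST: "S \<in> represented_order Ms" "T \<in> represented_order Ms" "S \<noteq> T" for S T
  proof (rule ccontr)
    assume "set S \<inter> set T \<noteq> {}"
    then obtain x where x: "x \<in> set S" "x \<in> set T" by blast
    obtain t k where tk: "t < length Ms" "k < dim_row (Ms ! t)" "S = list_of_vec (row (Ms ! t) k)"
      using row[OF ST(1)] by blast
    obtain t' k' where tk': "t' < length Ms" "k' < dim_row (Ms ! t')" "T = list_of_vec (row (Ms ! t') k')"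
      using row[OF ST(2)] by blast
    obtain l where l: "l < dim_col (Ms ! t)" "x = Ms ! t $$ (k, l)"
      using x(1) tk by (auto simp: set_row)
    obtain l' where l': "l' < dim_col (Ms ! t')" "x = Ms ! t' $$ (k', l')"
      using x(2) tk' by (auto simp: set_row)
    show False
      using inj_onD[OF inj, of "(t, k, l)" "(t', k', l')"] tk tk' l l' ST(3) by (simp add: pos entry_def)
  qed
  moreover have "(\<Union>S\<in>represented_order Ms. set S) = {..<n}"
    using img by (simp add: Union_represented_order entry_image)
  moreover have "finite (represented_order Ms)"
    by (simp add: represented_order_eq)
  ultimately show ?thesis
    by (auto simp: BP_def)
qed

section \<open>How often a fixed partitioned order is produced\<close>

lemma count_image_sum:
  "finite I \<Longrightarrow> count (image_mset f (\<Sum>i\<in>I. g i)) x = (\<Sum>i\<in>I. count (image_mset f (g i)) x)"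
  by (induction I rule: finite_induct) auto

lemma represented_order_snoc: "represented_order (Ms @ [M]) = represented_order Ms \<union> mat_rows M"
  by (auto simp: represented_order_eq)

text \<open>\<open>Q\<close> and \<open>R\<close> are separated by length, so filtering their union
  by length recovers each of them.\<close>

lemma blocks_less_Suc_iff:
  assumes "\<And>S. S \<in> Q \<Longrightarrow> length S < j" and "\<And>S. S \<in> R \<Longrightarrow> length S = j"
  shows "{S \<in> P. length S < Suc j} = Q \<union> R \<longleftrightarrow> {S \<in> P. length S < j} = Q \<and> {S \<in> P. length S = j} = R"
    (is "?L = _ \<longleftrightarrow> ?L1 = _ \<and> ?L2 = _")
proof -
  have "?L = ?L1 \<union> ?L2" by auto
  moreover have "?L1 = Q \<and> ?L2 = R" if "?L = Q \<union> R"
  proof -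
    have "?L1 = {S \<in> ?L. length S < j}" "?L2 = {S \<in> ?L. length S = j}" by auto
    then show ?thesis unfolding that using assms by auto
  qed
  ultimately show ?thesis by auto
qed

lemma BP_disjoint: "P \<in> BP n \<Longrightarrow> S \<in> P \<Longrightarrow> T \<in> P \<Longrightarrow> S \<noteq> T \<Longrightarrow> set S \<inter> set T = {}"
  unfolding BP_def by blast

text \<open>A call leads to \<open>P\<close> once if its matrices agree with \<open>P\<close> on the
  blocks shorter than \<open>j\<close> and \<open>\<mu>\<close> has the right multiplicities from
  \<open>j\<close> on; otherwise never. Induction on the number of remaining matrices.\<close>

lemma count_EnumBP_aux:
  assumes P: "P \<in> BP n"
    and "\<And>S. S \<in> represented_order Ms \<Longrightarrow> length S < j" and "j > 0"
  shows "count (image_mset represented_order (EnumBP_aux n \<mu> j Ms)) P =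
    of_bool ({S \<in> P. length S < j} = represented_order Ms \<and> (\<forall>k\<ge>j. card {S \<in> P. length S = k} = count \<mu> k))"
  using assms(2,3)
proof (induction "Suc (max_part \<mu>) - j" arbitrary: j Ms)
  case 0
  have finP: "finite P" using P by (simp add: BP_def)
  \<comment> \<open>Beyond the largest part all multiplicities vanish, so the condition on them says
    that \<open>P\<close> has no block of length at least \<open>j\<close>.\<close>
  have "count \<mu> k = 0" if "k \<ge> j" for k
    using 0 that max_part_ge[of k \<mu>] by (auto simp: count_eq_zero_iff)
  then have "(\<forall>k\<ge>j. card {S \<in> P. length S = k} = count \<mu> k) \<longleftrightarrow> (\<forall>k\<ge>j. \<forall>S\<in>P. length S \<noteq> k)"
    using finP by auto
  also have "\<dots> \<longleftrightarrow> (\<forall>S\<in>P. length S < j)"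
    using linorder_not_le by blast
  finally have "(\<forall>k\<ge>j. card {S \<in> P. length S = k} = count \<mu> k) \<longleftrightarrow> (\<forall>S\<in>P. length S < j)" .
  then have "({S \<in> P. length S < j} = represented_order Ms \<and> (\<forall>k\<ge>j. card {S \<in> P. length S = k} = count \<mu> k))
     \<longleftrightarrow> P = represented_order Ms"
    using 0(2) by auto
  then show ?case using 0 by (auto simp: EnumBP_aux_leaf)
next
  case (Suc d)
  then have j: "j \<le> max_part \<mu>" "j > 0" by auto
  have finP: "finite P" using P by (simp add: BP_def)
  define m where "m = count \<mu> j"
  define tail where "tail \<longleftrightarrow> (\<forall>k\<ge>Suc j. card {S \<in> P. length S = k} = count \<mu> k)"
  have all_tail: "(\<forall>k\<ge>j. card {S \<in> P. length S = k} = count \<mu> k)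
      \<longleftrightarrow> card {S \<in> P. length S = j} = m \<and> tail"
    unfolding tail_def m_def using le_eq_less_or_eq[of j] by (auto simp: Suc_le_eq)
  \<comment> \<open>The rows of \<open>M\<close> have length exactly \<open>j\<close>, so agreement
    below \<open>Suc j\<close> splits into the old agreement and equality of the new rows with the
    blocks of length \<open>j\<close>.\<close>
  have IH: "count (image_mset represented_order (EnumBP_aux n \<mu> (Suc j) (Ms @ [M]))) P =
      of_bool ({S \<in> P. length S < j} = represented_order Ms \<and> {S \<in> P. length S = j} = mat_rows M \<and> tail)"
    if "dim_col M = j" for M
  proof -
    have "count (image_mset represented_order (EnumBP_aux n \<mu> (Suc j) (Ms @ [M]))) P =
      of_bool ({S \<in> P. length S < Suc j} = represented_order Ms \<union> mat_rows M \<and> tail)"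
      unfolding tail_def represented_order_snoc[symmetric]
      using Suc.hyps(2) Suc.prems that
      by (intro Suc.hyps(1)) (auto simp: represented_order_snoc length_mat_rows less_Suc_eq)
    then show ?thesis
      using Suc.prems(1) that by (subst (asm) blocks_less_Suc_iff) (auto simp: length_mat_rows)
  qed
  let ?U = "{..<n} - (\<Union>M\<in>set Ms. elements_mat M)"
  let ?E = "fill_choices ?U m j"
  show ?case
  proof (cases "m = 0")
    case True
    have "mat_rows (0\<^sub>m 0 j :: nat mat) = {}" by (simp add: mat_rows_def)
    then show ?thesis
      using IH[of "0\<^sub>m 0 j"] True j finP EnumBP_aux_zero[of j \<mu> n Ms]
      unfolding all_tail by (auto simp: m_def)
  next
    case False
    have U: "finite ?U" by simp
    have finE: "finite ?E" by (rule finite_fill_choices[OF U])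
    \<comment> \<open>The part of the condition that does not depend on the chosen triple.\<close>
    let ?cond = "{S \<in> P. length S < j} = represented_order Ms \<and> tail"
    have "count (image_mset represented_order (EnumBP_aux n \<mu> j Ms)) P =
      (\<Sum>e\<in>?E. case e of (A, C, B) \<Rightarrow>
         count (image_mset represented_order (EnumBP_aux n \<mu> (Suc j) (Ms @ [fill_matrix m j C B]))) P)"
      using False j finE by (simp add: EnumBP_aux_step m_def count_image_sum case_prod_unfold)
    also have "\<dots> = (\<Sum>e\<in>?E. case e of (A, C, B) \<Rightarrow>
         of_bool (?cond \<and> mat_rows (fill_matrix m j C B) = {S \<in> P. length S = j}))"
      by (intro sum.cong refl) (auto simp: IH fill_matrix_def)
    also have "\<dots> = of_bool (?cond \<and> card {S \<in> P. length S = j} = m)"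
    proof (cases "?cond \<and> card {S \<in> P. length S = j} = m")
      case True
      have "\<exists>A C B. (A, C, B) \<in> ?E \<and> mat_rows (fill_matrix m j C B) = {S \<in> P. length S = j}"
      proof (rule ex_fill[OF U j(2)])
        fix S assume S: "S \<in> {S \<in> P. length S = j}"
        \<comment> \<open>Elements already placed belong to shorter blocks of \<open>P\<close>,
          hence to blocks disjoint from \<open>S\<close>; so \<open>S\<close> consists of elements
          still available.\<close>
        have "set S \<inter> set T = {}" if "T \<in> represented_order Ms" for T
        proof -
          have "T \<in> P" "length T < j" using that True by auto
          moreover have "S \<in> P" "S \<noteq> T" using S \<open>length T < j\<close> by auto
          ultimately show ?thesis using BP_disjoint[OF P] by blast
        qed
        then have "set S \<inter> (\<Union>M\<in>set Ms. elements_mat M) = {}"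
          unfolding Union_represented_order[symmetric] by blast
        moreover have "distinct S" "set S \<subseteq> {..<n}" using S P by (auto simp: BP_def)
        ultimately show "length S = j \<and> distinct S \<and> set S \<subseteq> ?U"
          using S by blast
      qed (use True finP BP_disjoint[OF P] in auto)
      then obtain A C B where e: "(A, C, B) \<in> ?E"
        and rows: "mat_rows (fill_matrix m j C B) = {S \<in> P. length S = j}" by blast
      have eq: "(?cond \<and> mat_rows (fill_matrix m j C' B') = {S \<in> P. length S = j}) \<longleftrightarrow> (A', C', B') = (A, C, B)"
        if "(A', C', B') \<in> ?E" for A' C' B'
        using True rows fill_unique[OF U j(2) e that] by (metis prod.inject)
      have "(\<Sum>e\<in>?E. case e of (A, C, B) \<Rightarrow>
         of_bool (?cond \<and> mat_rows (fill_matrix m j C B) = {S \<in> P. length S = j}))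
         = (\<Sum>e\<in>?E. if e = (A, C, B) then 1 else (0::nat))"
      proof (rule sum.cong[OF refl])
        fix e' assume "e' \<in> ?E"
        then show "(case e' of (A, C, B) \<Rightarrow>
            of_bool (?cond \<and> mat_rows (fill_matrix m j C B) = {S \<in> P. length S = j}))
          = (if e' = (A, C, B) then 1 else (0::nat))"
          by (cases e') (simp only: eq prod.case of_bool_def)
      qed
      also have "\<dots> = 1" using e finE by simp
      finally show ?thesis using True by simp
    next
      case False
      \<comment> \<open>If \<open>?cond\<close> holds, the cardinality is wrong, whereas every
        filled matrix has exactly \<open>m\<close> distinct rows; so all summands are 0.\<close>
      have "\<not> (?cond \<and> mat_rows (fill_matrix m j C B) = {S \<in> P. length S = j})"
        if "(A, C, B) \<in> ?E" for A C B
        using False card_mat_rows_fill[OF U j(2) that] by auto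
      then show ?thesis using False by (intro trans[OF sum.neutral]) auto
    qed
    finally show ?thesis unfolding all_tail by (simp add: conj_ac)
  qed
qed

section \<open>Block sizes as an integer partition, and the enumeration theorem\<close>

definition block_sizes :: "'a list set \<Rightarrow> nat multiset" where
  "block_sizes P = image_mset length (mset_set P)"

lemma count_block_sizes: "finite P \<Longrightarrow> count (block_sizes P) k = card {S \<in> P. length S = k}"
  by (auto simp: block_sizes_def count_image_mset vimage_def Int_def intro!: arg_cong[of _ _ card])

text \<open>A block has as many elements as its length, and the disjoint blocks cover
  \<open>{..<n}\<close>, so the lengths add up to \<open>n\<close>.\<close>

lemma block_sizes_in_int_partitions:
  assumes "P \<in> BP n"
  shows "block_sizes P \<in> int_partitions n"
proof -
  have "sum_mset (block_sizes P) = (\<Sum>S\<in>P. card (set S))"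
    unfolding block_sizes_def sum_unfold_sum_mset[symmetric]
    using assms by (intro sum.cong refl) (auto simp: BP_def distinct_card)
  also have "\<dots> = card (\<Union>S\<in>P. set S)"
    using assms by (intro card_UN_disjoint[symmetric]) (auto simp: BP_def)
  also have "\<dots> = n" using assms by (simp add: BP_def)
  finally show ?thesis
    using assms by (auto simp: int_partitions_def block_sizes_def BP_def)
qed

text \<open>At \<open>j = 1\<close> the empty list agrees with \<open>P\<close> because
  \<open>P\<close> has no empty block. Since 0 is not a part on either side, equal multiplicities
  from 1 on mean equal partitions.\<close>

lemma count_EnumBP_aux_start:
  assumes P: "P \<in> BP n" and \<mu>: "\<mu> \<in> int_partitions n"
  shows "count (image_mset represented_order (EnumBP_aux n \<mu> 1 [])) P = of_bool (\<mu> = block_sizes P)"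
proof -
  have 0: "count \<mu> 0 = 0" "count (block_sizes P) 0 = 0"
    using \<mu> block_sizes_in_int_partitions[OF P] by (auto simp: int_partitions_def count_eq_zero_iff)
  have "finite P" "[] \<notin> P" using P by (auto simp: BP_def)
  then have "count (image_mset represented_order (EnumBP_aux n \<mu> 1 [])) P =
    of_bool (\<forall>k\<ge>1. count (block_sizes P) k = count \<mu> k)"
    using P by (subst count_EnumBP_aux) (auto simp: represented_order_eq count_block_sizes)
  also have "(\<forall>k\<ge>1. count (block_sizes P) k = count \<mu> k) \<longleftrightarrow> \<mu> = block_sizes P"
    using 0 by (auto simp: multiset_eq_iff) (metis One_nat_def Suc_leI gr0I)
  finally show ?thesis .
qed

theorem theorem1:
  fixes n :: nat and part :: "nat \<Rightarrow> nat multiset"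
  assumes "n \<ge> 1"
    and "partition_listing n part"
  shows "(\<forall>Ms \<in># EnumBP part n. \<exists>i\<in>{1..num_partitions n}. is_matrix_rep n (part i) Ms) \<and>
         (\<forall>P \<in> BP n. count (image_mset represented_order (EnumBP part n)) P = 1) \<and>
         (\<forall>P. P \<in># image_mset represented_order (EnumBP part n) \<longrightarrow> P \<in> BP n)"
proof -
  let ?I = "{1..num_partitions n}"
  have bij: "bij_betw part ?I (int_partitions n)"
    using assms(2) by (simp add: partition_listing_def)
  \<comment> \<open>The invariant holds for the empty list, hence for every output; both validity
    claims about outputs are drawn from this.\<close>
  have out: "\<exists>i\<in>?I. part i \<in> int_partitions n \<and> partial_rep n (part i) Ms \<and> length Ms = max_part (part i)"
    if Ms: "Ms \<in># EnumBP part n" for Ms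
  proof -
    obtain i where i: "i \<in> ?I" "Ms \<in># EnumBP_aux n (part i) 1 []"
      using Ms by (auto simp: EnumBP_def set_mset_sum)
    have "partial_rep n (part i) []" by (simp add: partial_rep_def positions_def)
    then have "partial_rep n (part i) Ms \<and> length Ms = max_part (part i)"
      using i(2) by (intro EnumBP_aux_partial_rep) auto
    then show ?thesis
      using i(1) bij by (blast dest: bij_betwE)
  qed
  have "count (image_mset represented_order (EnumBP part n)) P = 1" if P: "P \<in> BP n" for P
  proof -
    obtain i where i: "i \<in> ?I" "part i = block_sizes P"
      using bij block_sizes_in_int_partitions[OF P] by (metis bij_betw_iff_bijections)
    have "count (image_mset represented_order (EnumBP part n)) P
        = (\<Sum>k\<in>?I. of_bool (part k = block_sizes P))"
      unfolding EnumBP_def count_image_sum[OF finite_atLeastAtMost]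
      using bij by (intro sum.cong refl count_EnumBP_aux_start[OF P]) (blast dest: bij_betwE)
    \<comment> \<open>The listing is injective, so \<open>i\<close> is the only index whose
      partition is that of the block sizes of \<open>P\<close>.\<close>
    also have "\<dots> = (\<Sum>k\<in>?I. if k = i then 1 else 0)"
    proof (rule sum.cong[OF refl])
      fix k assume "k \<in> ?I"
      then have "part k = block_sizes P \<longleftrightarrow> k = i"
        using i bij by (metis bij_betw_imp_inj_on inj_onD)
      then show "of_bool (part k = block_sizes P) = (if k = i then 1 else (0::nat))" by simp
    qed
    also have "\<dots> = 1" using i(1) by simp
    finally show ?thesis .
  qed
  moreover have "represented_order Ms \<in> BP n" "\<exists>i\<in>?I. is_matrix_rep n (part i) Ms"
    if "Ms \<in># EnumBP part n" for Ms
    using out[OF that] by (auto intro: represented_order_in_BP is_matrix_rep_partial_rep)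
  ultimately show ?thesis by (intro conjI ballI allI impI) auto
qed

end
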